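(* Let $N\ge2$ and let $\boldsymbol x=(x_1,\dots,x_N):\mathcal U\cup\mathcal U^*\to\mathbb R^N$ be the discrete confocal coordinates associated with integers $\alpha_1>\cdots>\alpha_N$. Let $i\ne j$, and consider the values $n_m$ with $m\neq i,j$ as fixed. Then there are functions $\phi_i$ and $\phi_j$, depending only on $n_i$ and only on $n_j$ respectively (besides the fixed $n_m$, $m\ne i,j$), such that $$\left\langle\Delta_i\boldsymbol x(n),\Delta_i\boldsymbol x(n+\tfrac12\boldsymbol f)\right\rangle=s^2\phi_i(n_i),$$ $$\left\langle\Delta_j\boldsymbol x(n-e_j+\tfrac12\boldsymbol f),\Delta_j\boldsymbol x(n-e_j+\boldsymbol f)\right\rangle=s^2\phi_j(n_j)$$ (whenever all points involved lie in $\mathcal U\cup\mathcal U^*$), where $$s(n_i,n_j)=\left|n_i-n_j+\frac{j-i}{2}+\frac12\right|^{1/2}$$ and $$\frac{\phi_i(n_i)}{\phi_j(n_j)}=-\frac{\prod_{m\ne i,j}\left(n_i-n_m+\frac{m-i}{2}+\frac12\right)}{\prod_{m=1}^N\left(n_i+\alpha_m+\frac{m-i}{2}+\frac12\right)}\cdot\frac{\prod_{m=1}^N\left(n_j+\alpha_m+\frac{m-j}{2}\right)}{\prod_{m\neq i,j}\left(n_j-n_m+\frac{m-j}{2}-\frac12\right)}.$$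
   Context: Discrete confocal coordinates: for $\alpha_1,\ldots,\alpha_N\in\mathbb Z$ with $\alpha_1>\cdots>\alpha_N$, let $$\mathcal U=\{n\in\mathbb Z^N \mid -\alpha_1\le n_1\le-\alpha_2\le n_2\le\cdots\le-\alpha_N\le n_N\},$$ $$\mathcal U^*=\{n\in(\mathbb Z+\tfrac12)^N \mid -\alpha_1\le n_1\le-\alpha_2\le n_2\le\cdots\le-\alpha_N\le n_N\},$$ and define $\boldsymbol x=(x_1,\dots,x_N)$ on $\mathcal U\cup\mathcal U^*$ by $$x_k(n)=D_k\prod_{i=1}^{k-1}\left(-n_i-\alpha_k-\tfrac{k-i}{2}+\tfrac12\right)_{1/2}\prod_{i=k}^N\left(n_i+\alpha_k+\tfrac{k-i}{2}\right)_{1/2},$$ $$D_k^{-1}=\prod_{i=1}^{k-1}\sqrt{\alpha_i-\alpha_k+\tfrac{i-k}{2}}\ \prod_{i=k+1}^N\sqrt{\alpha_k-\alpha_i+\tfrac{k-i}{2}},$$ where $(u)_{1/2}=\Gamma(u+\tfrac12)/\Gamma(u)$ for $u>0$ and $(0)_{1/2}=0$. Notation: $\Delta_i f(n)=f(n+e_i)-f(n)$, with $e_i$ the $i$-th coordinate vector; $\boldsymbol f=(1,\ldots,1)$. *)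

theory Defs
  imports "HOL-Analysis.Analysis" "HOL-Library.Function_Algebras"
begin

text \<open>Points and vectors of \<open>N\<close>-space are functions \<open>nat \<Rightarrow> real\<close>, of which only the coordinates
  \<open>1, \<dots>, N\<close> are relevant (the formulas do arithmetic with the coordinate indices, so a finite index
  type would be awkward); they are added and subtracted pointwise.\<close>

definition inner_on :: "nat \<Rightarrow> (nat \<Rightarrow> real) \<Rightarrow> (nat \<Rightarrow> real) \<Rightarrow> real" where
  "inner_on N u v = (\<Sum>k = 1..N. u k * v k)"

definition evec :: "nat \<Rightarrow> nat \<Rightarrow> real" where
  "evec i = (\<lambda>m. if m = i then 1 else 0)"

definition diag :: "real \<Rightarrow> nat \<Rightarrow> real" where \<comment> \<open>\<open>c \<cdot> f\<close> with \<open>f = (1, \<dots>, 1)\<close>\<close>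
  "diag c = (\<lambda>m. c)"

definition fdiff :: "nat \<Rightarrow> ((nat \<Rightarrow> real) \<Rightarrow> nat \<Rightarrow> real) \<Rightarrow> (nat \<Rightarrow> real) \<Rightarrow> nat \<Rightarrow> real" where
  "fdiff i f n = f (n + evec i) - f n"

definition interlaced :: "nat \<Rightarrow> (nat \<Rightarrow> int) \<Rightarrow> (nat \<Rightarrow> real) \<Rightarrow> bool" where
  "interlaced N \<alpha> n \<longleftrightarrow>
     (\<forall>m\<in>{1..N}. - of_int (\<alpha> m) \<le> n m) \<and> (\<forall>m\<in>{1..<N}. n m \<le> - of_int (\<alpha> (m + 1)))"

definition dom_int :: "nat \<Rightarrow> (nat \<Rightarrow> int) \<Rightarrow> (nat \<Rightarrow> real) set" where
  "dom_int N \<alpha> = {n. (\<forall>m\<in>{1..N}. n m \<in> \<int>) \<and> interlaced N \<alpha> n}"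

definition dom_half :: "nat \<Rightarrow> (nat \<Rightarrow> int) \<Rightarrow> (nat \<Rightarrow> real) set" where
  "dom_half N \<alpha> = {n. (\<forall>m\<in>{1..N}. n m - 1/2 \<in> \<int>) \<and> interlaced N \<alpha> n}"

text \<open>The symbol \<open>(u)\<^sub>1\<^sub>/\<^sub>2\<close>. It is only meaningful for \<open>u \<ge> 0\<close>; all arguments occurring below are
  nonnegative on the domain of the coordinates.\<close>

definition half_poch :: "real \<Rightarrow> real" where
  "half_poch u = (if u = 0 then 0 else Gamma (u + 1/2) / Gamma u)"

definition conf_const :: "nat \<Rightarrow> (nat \<Rightarrow> int) \<Rightarrow> nat \<Rightarrow> real" where
  "conf_const N \<alpha> k = inverse
     ((\<Prod>i\<in>{1..<k}. sqrt (of_int (\<alpha> i) - of_int (\<alpha> k) + (real i - real k) / 2)) *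
      (\<Prod>i\<in>{k+1..N}. sqrt (of_int (\<alpha> k) - of_int (\<alpha> i) + (real k - real i) / 2)))"

definition conf_coord :: "nat \<Rightarrow> (nat \<Rightarrow> int) \<Rightarrow> (nat \<Rightarrow> real) \<Rightarrow> nat \<Rightarrow> real" where
  "conf_coord N \<alpha> n k = conf_const N \<alpha> k *
     (\<Prod>i\<in>{1..<k}. half_poch (- n i - of_int (\<alpha> k) - (real k - real i) / 2 + 1/2)) *
     (\<Prod>i\<in>{k..N}. half_poch (n i + of_int (\<alpha> k) + (real k - real i) / 2))"

definition s_fun :: "nat \<Rightarrow> nat \<Rightarrow> real \<Rightarrow> real \<Rightarrow> real" where
  "s_fun i j a b = sqrt \<bar>a - b + (real j - real i) / 2 + 1/2\<bar>"

end

theory Submission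
  imports Defs "HOL-Computational_Algebra.Polynomial"
begin

text \<open>Since \<open>(u)\<^sub>1\<^sub>/\<^sub>2 (u + 1/2)\<^sub>1\<^sub>/\<^sub>2 = u\<close>, the products \<open>\<Delta>\<^sub>i x\<^sub>k(n) \<sqdot> \<Delta>\<^sub>i x\<^sub>k(n + f/2)\<close> are rational in \<open>n\<close>. With
  \<open>a\<^sub>k = \<alpha>\<^sub>k + k/2\<close> and \<open>y\<^sub>m = n\<^sub>m - m/2\<close> they equal
  \<open>\<Prod>\<^bsub>m \<noteq> i\<^esub> (a\<^sub>k + y\<^sub>m) / (4 (a\<^sub>k + y\<^sub>i + 1/2) \<Prod>\<^bsub>m \<noteq> k\<^esub> (a\<^sub>k - a\<^sub>m))\<close>,
  and the sum over \<open>k\<close> is the partial fraction expansion of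
  \<open>z \<mapsto> \<Prod>\<^bsub>m \<noteq> i\<^esub> (z + y\<^sub>m) / \<Prod>\<^sub>m (z - a\<^sub>m)\<close> at \<open>z = - y\<^sub>i - 1/2\<close>, up to the factor \<open>- 1/4\<close>.
  The factor \<open>m = j\<close> of the numerator is \<open>\<plusminus> s\<^sup>2\<close>, with a sign that depends only on the order of \<open>i\<close> and
  \<open>j\<close> because the coordinates interlace.\<close>

section \<open>Identities for the symbol \<open>half_poch\<close>\<close>

lemma Gamma_plus1_pos: "(u::real) > 0 \<Longrightarrow> Gamma (u + 1) = u * Gamma u"
  by (intro Gamma_plus1) (auto elim!: nonpos_Ints_cases)

text \<open>The two Gamma quotients telescope to Gamma(u + 1) / Gamma(u). At u = 0 the convention
  (0)_{1/2} = 0 gives the same value.\<close>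

lemma half_poch_mult_shift:
  assumes "u \<ge> 0"
  shows "half_poch u * half_poch (u + 1/2) = u"
proof (cases "u = 0")
  case False
  with assms have "u > 0" by simp
  then have "Gamma (u + 1/2) \<noteq> 0" "Gamma u \<noteq> 0" "Gamma (u + 1) = u * Gamma u"
    by (auto simp: Gamma_plus1_pos intro!: less_imp_neq[OF Gamma_real_pos, symmetric])
  then show ?thesis
    using \<open>u > 0\<close> by (simp add: half_poch_def add.commute[of u 1])
qed (simp add: half_poch_def)

text \<open>Over the common denominator Gamma(u + 1) the numerators are (u + 1/2) Gamma(u + 1/2) and
  u Gamma(u + 1/2), so their difference leaves the factor 1/2. At u = 0 the second one vanishes, in
  accordance with (0)_{1/2} = 0.\<close>

lemma half_poch_diff:
  assumes "u \<ge> 0"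
  shows "half_poch (u + 1) - half_poch u = Gamma (u + 1/2) / (2 * Gamma (u + 1))"
proof -
  have G: "Gamma (u + 1 + 1/2) = (u + 1/2) * Gamma (u + 1/2)"
    using assms Gamma_plus1_pos[of "u + 1/2"] by (simp add: add_ac)
  show ?thesis
  proof (cases "u = 0")
    case False
    with assms have "u > 0" by simp
    then have "Gamma u \<noteq> 0" and G1: "Gamma (u + 1) = u * Gamma u"
      by (auto simp: Gamma_plus1_pos intro!: less_imp_neq[OF Gamma_real_pos, symmetric])
    then show ?thesis
      unfolding half_poch_def G G1 using \<open>u > 0\<close>
      by (simp add: divide_simps) (simp add: algebra_simps)
  qed (use G in \<open>simp add: half_poch_def\<close>)
qed

lemma half_poch_diff_mult_shift:
  assumes "u \<ge> 0"
  shows "(half_poch (u + 1) - half_poch u) * (half_poch (u + 3/2) - half_poch (u + 1/2))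
    = 1 / (4 * (u + 1/2))"
proof -
  have "half_poch (u + 3/2) - half_poch (u + 1/2) = Gamma (u + 1) / (2 * Gamma (u + 3/2))"
    using half_poch_diff[of "u + 1/2"] assms by (simp add: add_ac)
  moreover have "Gamma (u + 3/2) = (u + 1/2) * Gamma (u + 1/2)"
    using assms Gamma_plus1_pos[of "u + 1/2"] by (simp add: add_ac)
  moreover have "Gamma (u + 1) \<noteq> 0" "Gamma (u + 1/2) \<noteq> 0"
    using assms by (auto intro!: less_imp_neq[OF Gamma_real_pos, symmetric])
  ultimately show ?thesis
    using assms by (simp add: half_poch_diff)
qed

section \<open>Partial fractions with simple poles\<close>

text \<open>Lagrange interpolation: \<open>q\<close> is the interpolant of \<open>p\<close> at the
  nodes \<open>a k\<close>, with unnormalised basis polynomials \<open>B k\<close>. Both have degree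
  below the number of nodes, so \<open>q = p\<close>; evaluating at \<open>w\<close> and dividing by
  the product of all \<open>w - a m\<close> gives the expansion.\<close>

lemma partial_fractions_distinct_roots:
  fixes p :: "'a::field poly"
  assumes fin: "finite A" and inj: "inj_on a A" and deg: "degree p < card A"
    and w: "\<And>k. k \<in> A \<Longrightarrow> w \<noteq> a k"
  shows "(\<Sum>k\<in>A. poly p (a k) / ((w - a k) * (\<Prod>m\<in>A - {k}. a k - a m)))
    = poly p w / (\<Prod>m\<in>A. w - a m)"
proof -
  define B where "B k = (\<Prod>m\<in>A - {k}. [:- a m, 1:])" for k
  define C where "C k = poly p (a k) / (\<Prod>m\<in>A - {k}. a k - a m)" for k
  define q where "q = (\<Sum>k\<in>A. smult (C k) (B k))"
  have poly_B: "poly (B k) z = (\<Prod>m\<in>A - {k}. z - a m)" for k z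
    by (simp add: B_def poly_prod)
  have "card A > 0" using deg by simp
  have "degree (B k) < card A" if "k \<in> A" for k
  proof -
    have "degree (B k) \<le> (\<Sum>m\<in>A - {k}. degree [:- a m, 1:])"
      unfolding B_def by (rule degree_prod_sum_le[unfolded o_def]) (use fin in simp)
    then show ?thesis
      using \<open>card A > 0\<close> fin that by (simp add: card_Diff_singleton)
  qed
  then have "degree q \<le> card A - 1"
    unfolding q_def using fin
    by (intro degree_sum_le order.trans[OF degree_smult_le]) fastforce+
  then have "degree q < card A" using \<open>card A > 0\<close> by simp
  moreover have "poly q (a l) = poly p (a l)" if "l \<in> A" for l
  proof -
    have "(\<Sum>k\<in>A - {l}. C k * poly (B k) (a l)) = 0"
    proof (rule sum.neutral, rule ballI)
      fix k assume "k \<in> A - {l}"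
      then have "poly (B k) (a l) = 0"
        unfolding poly_B using that fin by (intro prod_zero) auto
      then show "C k * poly (B k) (a l) = 0" by simp
    qed
    moreover have "(\<Prod>m\<in>A - {l}. a l - a m) \<noteq> 0"
      using fin inj that by (auto simp: inj_on_def)
    ultimately show ?thesis
      using fin that by (simp add: q_def poly_sum sum.remove[of A l])
        (simp add: C_def poly_B)
  qed
  ultimately have "q = p"
    using deg inj by (intro poly_eqI_degree[of "a ` A"]) (auto simp: card_image)
  then have "poly p w = (\<Sum>k\<in>A. C k * (\<Prod>m\<in>A - {k}. w - a m))"
    by (auto simp: q_def poly_sum poly_B)
  then have "poly p w / (\<Prod>m\<in>A. w - a m)
    = (\<Sum>k\<in>A. C k * (\<Prod>m\<in>A - {k}. w - a m) / (\<Prod>m\<in>A. w - a m))"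
    by (simp add: sum_divide_distrib)
  also have "\<dots> = (\<Sum>k\<in>A. poly p (a k) / ((w - a k) * (\<Prod>m\<in>A - {k}. a k - a m)))"
  proof (rule sum.cong[OF refl])
    fix k assume "k \<in> A"
    moreover have "(\<Prod>m\<in>A - {k}. w - a m) \<noteq> 0"
      using fin w by auto
    ultimately show "C k * (\<Prod>m\<in>A - {k}. w - a m) / (\<Prod>m\<in>A. w - a m)
      = poly p (a k) / ((w - a k) * (\<Prod>m\<in>A - {k}. a k - a m))"
      using fin by (simp add: C_def prod.remove[of A k])
  qed
  finally show ?thesis by simp
qed

section \<open>Single factors, signs and normalising constants\<close>

lemma strict_antimono_int_gap:
  fixes \<alpha> :: "nat \<Rightarrow> int"
  assumes "strict_antimono_on {1..N} \<alpha>" "1 \<le> k" "k \<le> m" "m \<le> N"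
  shows "real m - real k \<le> of_int (\<alpha> k) - of_int (\<alpha> m)"
  using assms(3,4)
proof (induction m rule: dec_induct)
  case (step m)
  have "\<alpha> (Suc m) < \<alpha> m"
    using monotone_onD[OF assms(1), of m "Suc m"] step assms(2) by auto
  then show ?case using step by simp
qed simp

text \<open>Merges the two products of a coordinate into one over all m, so that the factor in
  direction i can be split off without distinguishing i < k from i \<ge> k.\<close>

definition conf_factor :: "(nat \<Rightarrow> int) \<Rightarrow> nat \<Rightarrow> nat \<Rightarrow> real \<Rightarrow> real" where
  "conf_factor \<alpha> k m t =
    (if m < k then half_poch (- t - of_int (\<alpha> k) - (real k - real m) / 2 + 1/2)
     else half_poch (t + of_int (\<alpha> k) + (real k - real m) / 2))"

text \<open>For m \<noteq> k this is the sign of a_k - a_m, with a_m = \<alpha>_m + m/2 strictly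
  decreasing in m. The same sign arises when the reflected argument of \<open>conf_factor\<close>
  for m < k is turned back into a_k + y_m.\<close>

definition index_sign :: "nat \<Rightarrow> nat \<Rightarrow> real" where
  "index_sign k m = (if m < k then -1 else 1)"

lemma prod_if_less_split:
  fixes f g :: "nat \<Rightarrow> 'a::comm_monoid_mult"
  assumes "k \<in> {1..N}"
  shows "(\<Prod>m = 1..N. if m < k then f m else g m) = (\<Prod>m\<in>{1..<k}. f m) * (\<Prod>m\<in>{k..N}. g m)"
proof -
  have "{1..N} = {1..<k} \<union> {k..N}" using assms by auto
  then show ?thesis
    by (simp add: prod.union_disjoint ivl_disj_int)
qed

lemma conf_coord_eq_prod:
  assumes "k \<in> {1..N}"
  shows "conf_coord N \<alpha> n k = conf_const N \<alpha> k * (\<Prod>m = 1..N. conf_factor \<alpha> k m (n m))"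
  using assms unfolding conf_coord_def conf_factor_def
  by (subst prod_if_less_split) (auto simp: mult.assoc)

text \<open>The radicands are the distances between a_k and a_m: the gap of \<alpha> is at least the
  difference of the indices, so the half-index shift cannot reverse the order. Squaring removes the
  roots, and the signs turn distances into differences.\<close>

lemma conf_const_square:
  assumes anti: "strict_antimono_on {1..N} \<alpha>" and k: "k \<in> {1..N}"
  defines "a \<equiv> \<lambda>m. of_int (\<alpha> m) + real m / 2"
  shows "(conf_const N \<alpha> k)\<^sup>2 * (\<Prod>m = 1..N. index_sign k m)
    = 1 / (\<Prod>m\<in>{1..N} - {k}. a k - a m)"
proof -
  have split: "{1..N} - {k} = {1..<k} \<union> {k+1..N}" using k by auto
  have "(\<Prod>m\<in>{1..<k}. sqrt (of_int (\<alpha> m) - of_int (\<alpha> k) + (real m - real k) / 2)) *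
      (\<Prod>m\<in>{k+1..N}. sqrt (of_int (\<alpha> k) - of_int (\<alpha> m) + (real k - real m) / 2))
    = (\<Prod>m\<in>{1..N} - {k}. sqrt (index_sign k m * (a k - a m)))"
    unfolding split
    by (subst prod.union_disjoint)
       (auto simp: index_sign_def a_def algebra_simps diff_divide_distrib intro!: arg_cong2[where f = "(*)"] prod.cong)
  then have "(conf_const N \<alpha> k)\<^sup>2 = inverse (\<Prod>m\<in>{1..N} - {k}. (sqrt (index_sign k m * (a k - a m)))\<^sup>2)"
    by (simp add: conf_const_def power_inverse prod_power_distrib)
  also have "(\<Prod>m\<in>{1..N} - {k}. (sqrt (index_sign k m * (a k - a m)))\<^sup>2)
    = (\<Prod>m\<in>{1..N} - {k}. index_sign k m * (a k - a m))"
  proof (rule prod.cong[OF refl])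
    fix m assume m: "m \<in> {1..N} - {k}"
    have "index_sign k m * (a k - a m) \<ge> 0"
    proof (cases "m < k")
      case True
      then show ?thesis
        using strict_antimono_int_gap[OF anti, of m k] k m by (auto simp: index_sign_def a_def field_simps)
    next
      case False
      then show ?thesis
        using strict_antimono_int_gap[OF anti, of k m] k m by (auto simp: index_sign_def a_def field_simps)
    qed
    then show "(sqrt (index_sign k m * (a k - a m)))\<^sup>2 = index_sign k m * (a k - a m)" by simp
  qed
  also have "\<dots> = (\<Prod>m\<in>{1..N} - {k}. index_sign k m) * (\<Prod>m\<in>{1..N} - {k}. a k - a m)"
    by (rule prod.distrib)
  finally have "(conf_const N \<alpha> k)\<^sup>2
    = inverse ((\<Prod>m\<in>{1..N} - {k}. index_sign k m) * (\<Prod>m\<in>{1..N} - {k}. a k - a m))" .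
  moreover have "(\<Prod>m = 1..N. index_sign k m) = (\<Prod>m\<in>{1..N} - {k}. index_sign k m)"
    using k by (subst prod.remove[of _ k]) (auto simp: index_sign_def)
  moreover have "(\<Prod>m\<in>{1..N} - {k}. index_sign k m) \<noteq> 0"
    by (auto simp: index_sign_def)
  ultimately show ?thesis
    by (simp add: field_simps)
qed

section \<open>Consequences of interlacing for the factors\<close>

lemma interlaced_lower:
  assumes "strict_antimono_on {1..N} \<alpha>" "interlaced N \<alpha> n" "1 \<le> k" "k \<le> m" "m \<le> N"
  shows "(real m - real k) / 2 \<le> n m + of_int (\<alpha> k) + (real k - real m) / 2"
proof -
  have "- of_int (\<alpha> m) \<le> n m" using assms by (auto simp: interlaced_def)
  then show ?thesis
    using strict_antimono_int_gap[OF assms(1,3-5)] by (simp add: field_simps)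
qed

lemma interlaced_upper:
  assumes "strict_antimono_on {1..N} \<alpha>" "interlaced N \<alpha> n" "1 \<le> m" "m < k" "k \<le> N"
  shows "(real k - real m) / 2 \<le> - n m - of_int (\<alpha> k) - (real k - real m) / 2 + 1"
proof -
  have "n m \<le> - of_int (\<alpha> (m + 1))" using assms by (auto simp: interlaced_def)
  then show ?thesis
    using strict_antimono_int_gap[OF assms(1), of "m + 1" k] assms by (simp add: field_simps)
qed

lemma conf_factor_mult_shift:
  assumes "strict_antimono_on {1..N} \<alpha>" "interlaced N \<alpha> n" "interlaced N \<alpha> (n + diag (1/2))"
    and "k \<in> {1..N}" "m \<in> {1..N}"
  shows "conf_factor \<alpha> k m (n m) * conf_factor \<alpha> k m (n m + 1/2)
    = index_sign k m * (n m + of_int (\<alpha> k) + (real k - real m) / 2)"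
proof (cases "m < k")
  case True
  \<comment> \<open>For m < k the argument decreases as n_m grows, so the smaller of the two
    arguments belongs to n + f/2. Its nonnegativity therefore comes from interlacing at the shifted
    point.\<close>
  let ?u = "- n m - of_int (\<alpha> k) - (real k - real m) / 2"
  have "?u \<ge> 0"
    using interlaced_upper[OF assms(1,3), of m k] True assms(4,5)
    by (auto simp: diag_def field_simps)
  from half_poch_mult_shift[OF this] have "half_poch (?u + 1/2) * half_poch ?u = ?u"
    by (simp only: mult.commute)
  moreover have "- (n m + 1/2) - of_int (\<alpha> k) - (real k - real m) / 2 + 1/2 = ?u"
    by simp
  ultimately show ?thesis
    unfolding conf_factor_def index_sign_def using True by (simp only: if_True) simp
next
  case False
  let ?u = "n m + of_int (\<alpha> k) + (real k - real m) / 2"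
  have "?u \<ge> 0"
    using False assms(4,5) by (intro order.trans[OF _ interlaced_lower[OF assms(1,2)]]) auto
  from half_poch_mult_shift[OF this] show ?thesis
    using False by (simp add: conf_factor_def index_sign_def add_ac)
qed

lemma conf_factor_diff_mult_shift:
  assumes "strict_antimono_on {1..N} \<alpha>" "interlaced N \<alpha> n"
    "interlaced N \<alpha> (n + diag (1/2) + evec i)"
    and "k \<in> {1..N}" "i \<in> {1..N}"
  defines "d \<equiv> n i + of_int (\<alpha> k) + (real k - real i) / 2 + 1/2"
  shows "(conf_factor \<alpha> k i (n i + 1) - conf_factor \<alpha> k i (n i)) *
      (conf_factor \<alpha> k i (n i + 3/2) - conf_factor \<alpha> k i (n i + 1/2))
    = index_sign k i / (4 * d)" (is "?lhs = ?rhs")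
    and "d \<noteq> 0"
proof -
  have "?lhs = ?rhs \<and> d \<noteq> 0"
  proof (cases "i < k")
    case True
    \<comment> \<open>The smallest of the four arguments, attained at n_i + 3/2. Reflection swaps
      the roles of the two differences and reverses both, so their product keeps its form; the sign
      comes only from d = -(u + 1/2).\<close>
    let ?u = "- n i - of_int (\<alpha> k) - (real k - real i) / 2 - 1"
    have u: "?u \<ge> 0"
      using interlaced_upper[OF assms(1,3), of i k] True assms(4,5)
      by (auto simp: diag_def evec_def field_simps)
    have d: "d = - (?u + 1/2)" by (simp add: d_def)
    have arg: "- (n i + 1) - of_int (\<alpha> k) - (real k - real i) / 2 + 1/2 = ?u + 1/2"
      "- n i - of_int (\<alpha> k) - (real k - real i) / 2 + 1/2 = ?u + 3/2"
      "- (n i + 3/2) - of_int (\<alpha> k) - (real k - real i) / 2 + 1/2 = ?u"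
      "- (n i + 1/2) - of_int (\<alpha> k) - (real k - real i) / 2 + 1/2 = ?u + 1"
      by simp_all
    have "?lhs = (half_poch (?u + 1/2) - half_poch (?u + 3/2)) * (half_poch ?u - half_poch (?u + 1))"
      unfolding conf_factor_def arg using True by (simp only: if_True)
    also have "\<dots> = (half_poch (?u + 1) - half_poch ?u) * (half_poch (?u + 3/2) - half_poch (?u + 1/2))"
      by (subst minus_mult_minus[symmetric]) (simp only: minus_diff_eq mult.commute)
    also have "\<dots> = ?rhs"
      unfolding half_poch_diff_mult_shift[OF u] d using True u by (simp add: index_sign_def field_simps)
    finally show ?thesis using d u by linarith
  next
    case False
    let ?u = "n i + of_int (\<alpha> k) + (real k - real i) / 2"
    have u: "?u \<ge> 0"
      using False assms(4,5) by (intro order.trans[OF _ interlaced_lower[OF assms(1,2)]]) auto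
    have d: "d = ?u + 1/2" by (simp add: d_def)
    have "?lhs = (half_poch (?u + 1) - half_poch ?u) * (half_poch (?u + 3/2) - half_poch (?u + 1/2))"
      using False by (simp add: conf_factor_def add_ac)
    also have "\<dots> = ?rhs"
      unfolding half_poch_diff_mult_shift[OF u] d using False by (simp add: index_sign_def)
    finally show ?thesis using d u by linarith
  qed
  then show "?lhs = ?rhs" "d \<noteq> 0" by auto
qed

section \<open>The scalar product in closed form\<close>

lemma fdiff_conf_coord:
  assumes "k \<in> {1..N}" "i \<in> {1..N}"
  shows "fdiff i (conf_coord N \<alpha>) n k = conf_const N \<alpha> k *
    (conf_factor \<alpha> k i (n i + 1) - conf_factor \<alpha> k i (n i)) *
    (\<Prod>m\<in>{1..N} - {i}. conf_factor \<alpha> k m (n m))"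
proof -
  have "(\<Prod>m\<in>{1..N} - {i}. conf_factor \<alpha> k m ((n + evec i) m))
    = (\<Prod>m\<in>{1..N} - {i}. conf_factor \<alpha> k m (n m))"
    by (intro prod.cong) (auto simp: evec_def)
  moreover have "(n + evec i) i = n i + 1"
    by (simp add: evec_def)
  ultimately show ?thesis
    unfolding fdiff_def minus_apply conf_coord_eq_prod[OF assms(1)]
      prod.remove[OF finite_atLeastAtMost assms(2)]
    by (simp only: right_diff_distrib left_diff_distrib mult.assoc)
qed

lemma inner_fdiff_conf_coord:
  assumes anti: "strict_antimono_on {1..N} \<alpha>" and i: "i \<in> {1..N}"
    and dom: "interlaced N \<alpha> n" "interlaced N \<alpha> (n + diag (1/2))"
      "interlaced N \<alpha> (n + diag (1/2) + evec i)"
  shows "inner_on N (fdiff i (conf_coord N \<alpha>) n) (fdiff i (conf_coord N \<alpha>) (n + diag (1/2)))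
    = (\<Prod>m\<in>{1..N} - {i}. n i - n m + (real m - real i) / 2 + 1/2)
      / (\<Prod>m = 1..N. n i + of_int (\<alpha> m) + (real m - real i) / 2 + 1/2) / 4"
proof -
  define a where "a m = of_int (\<alpha> m) + real m / 2" for m
  define y where "y m = n m - real m / 2" for m
  define p where "p = (\<Prod>m\<in>{1..N} - {i}. [:y m, 1:])"
  define w where "w = - y i - 1/2"
  have poly_p: "poly p z = (\<Prod>m\<in>{1..N} - {i}. z + y m)" for z
    by (simp add: p_def poly_prod add.commute)
  \<comment> \<open>\<open>w - a k\<close> is the negative of the denominator \<open>d\<close> of
    the difference formula, which is nonzero on the domain.\<close>
  have w: "w \<noteq> a k" if "k \<in> {1..N}" for k
    using conf_factor_diff_mult_shift(2)[OF anti dom(1,3) that i]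
    by (auto simp: w_def a_def y_def field_simps)
  have "inner_on N (fdiff i (conf_coord N \<alpha>) n) (fdiff i (conf_coord N \<alpha>) (n + diag (1/2)))
    = (\<Sum>k = 1..N. - 1/4 * (poly p (a k) / ((w - a k) * (\<Prod>m\<in>{1..N} - {k}. a k - a m))))"
    unfolding inner_on_def
  proof (rule sum.cong[OF refl])
    fix k assume k: "k \<in> {1..N}"
    let ?g = "conf_factor \<alpha> k"
    let ?d = "n i + of_int (\<alpha> k) + (real k - real i) / 2 + 1/2"
    have shift: "(n + diag (1/2)) m = n m + 1/2" "n i + 1/2 + 1 = n i + 3/2" for m
      by (auto simp: diag_def)
    have "fdiff i (conf_coord N \<alpha>) n k * fdiff i (conf_coord N \<alpha>) (n + diag (1/2)) k
      = (conf_const N \<alpha> k)\<^sup>2 *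
        ((?g i (n i + 1) - ?g i (n i)) * (?g i (n i + 3/2) - ?g i (n i + 1/2))) *
        (\<Prod>m\<in>{1..N} - {i}. ?g m (n m) * ?g m (n m + 1/2))"
      unfolding fdiff_conf_coord[OF k i] shift prod.distrib power2_eq_square by (simp only: mult_ac)
    also have "(\<Prod>m\<in>{1..N} - {i}. ?g m (n m) * ?g m (n m + 1/2))
      = (\<Prod>m\<in>{1..N} - {i}. index_sign k m * (a k + y m))"
      by (intro prod.cong refl, subst conf_factor_mult_shift[OF anti dom(1,2) k])
         (auto simp: a_def y_def field_simps)
    also have "\<dots> = (\<Prod>m\<in>{1..N} - {i}. index_sign k m) * poly p (a k)"
      by (simp add: prod.distrib poly_p)
    also have "(?g i (n i + 1) - ?g i (n i)) * (?g i (n i + 3/2) - ?g i (n i + 1/2))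
      = index_sign k i * (- 1/4 / (w - a k))"
    proof -
      have "?d = - (w - a k)" by (simp add: w_def a_def y_def field_simps)
      then show ?thesis
        unfolding conf_factor_diff_mult_shift(1)[OF anti dom(1,3) k i]
        by (simp only: mult_minus_right divide_minus_right) simp
    qed
    \<comment> \<open>The sign from direction i completes the signs of the other directions to the
      full product, exactly what \<open>conf_const_square\<close> absorbs.\<close>
    also have "(conf_const N \<alpha> k)\<^sup>2 * (index_sign k i * (- 1/4 / (w - a k))) *
        ((\<Prod>m\<in>{1..N} - {i}. index_sign k m) * poly p (a k))
      = ((conf_const N \<alpha> k)\<^sup>2 * (\<Prod>m = 1..N. index_sign k m)) * (- 1/4 / (w - a k)) * poly p (a k)"
      unfolding prod.remove[OF finite_atLeastAtMost i] by (simp only: mult_ac)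
    also have "\<dots> = - 1/4 * (poly p (a k) / ((w - a k) * (\<Prod>m\<in>{1..N} - {k}. a k - a m)))"
      unfolding conf_const_square[OF anti k] a_def by simp
    finally show "fdiff i (conf_coord N \<alpha>) n k * fdiff i (conf_coord N \<alpha>) (n + diag (1/2)) k
      = - 1/4 * (poly p (a k) / ((w - a k) * (\<Prod>m\<in>{1..N} - {k}. a k - a m)))" .
  qed
  also have "\<dots> = - 1/4 * (poly p w / (\<Prod>m = 1..N. w - a m))"
    unfolding sum_distrib_left[symmetric]
  proof (subst partial_fractions_distinct_roots)
    \<comment> \<open>The half-index shift recovers at most half of the drop of \<alpha>, so the
      nodes stay distinct.\<close>
    have "a m < a k" if "k \<in> {1..N}" "m \<in> {1..N}" "k < m" for k m
      using strict_antimono_int_gap[OF anti, of k m] that by (auto simp: a_def field_simps)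
    then show "inj_on a {1..N}"
      by (intro linorder_inj_onI) force+
    have "degree p \<le> (\<Sum>m\<in>{1..N} - {i}. degree [:y m, 1:])"
      unfolding p_def by (rule degree_prod_sum_le[unfolded o_def]) simp
    then show "degree p < card {1..N}"
      using i by (auto simp: card_Diff_singleton)
  qed (use w in auto)
  also have "poly p w = (\<Prod>m\<in>{1..N} - {i}. - (n i - n m + (real m - real i) / 2 + 1/2))"
    unfolding poly_p by (intro prod.cong) (auto simp: w_def y_def field_simps)
  also have "\<dots> = (- 1) ^ (N - 1) * (\<Prod>m\<in>{1..N} - {i}. n i - n m + (real m - real i) / 2 + 1/2)"
    using i by (subst prod_uminus) (simp add: card_Diff_singleton)
  also have "(\<Prod>m = 1..N. w - a m)
    = (\<Prod>m = 1..N. - (n i + of_int (\<alpha> m) + (real m - real i) / 2 + 1/2))"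
    by (intro prod.cong) (auto simp: w_def a_def y_def field_simps)
  also have "\<dots> = (- 1) ^ N * (\<Prod>m = 1..N. n i + of_int (\<alpha> m) + (real m - real i) / 2 + 1/2)"
    by (subst prod_uminus) simp
  \<comment> \<open>There are N - 1 reversed factors above and N below; the one surplus sign cancels
    the sign of -1/4.\<close>
  also have "(- 1 :: real) ^ N = - ((- 1) ^ (N - 1))"
    using i by (cases N) auto
  also have "- 1/4 * ((- 1) ^ (N - 1) * A / (- ((- 1) ^ (N - 1)) * B)) = A / B / 4" for A B :: real
    by simp
  finally show ?thesis .
qed

section \<open>Splitting off s^2 and identifying the two functions\<close>

theorem proposition6p6:
  fixes N i j :: nat and \<alpha> :: "nat \<Rightarrow> int" and c :: "nat \<Rightarrow> real"
  defines "x \<equiv> conf_coord N \<alpha>" and "\<D> \<equiv> dom_int N \<alpha> \<union> dom_half N \<alpha>"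
  assumes "N \<ge> 2" and "strict_antimono_on {1..N} \<alpha>"
    and "i \<in> {1..N}" and "j \<in> {1..N}" and "i \<noteq> j"
  shows "\<exists>\<phi>\<^sub>i \<phi>\<^sub>j :: real \<Rightarrow> real. \<forall>n. (\<forall>m\<in>{1..N} - {i, j}. n m = c m) \<longrightarrow>
    (let P = {n, n + evec i, n + diag (1/2), n + diag (1/2) + evec i};
         Q = {n - evec j + diag (1/2), n + diag (1/2), n - evec j + diag 1, n + diag 1}
     in
       (P \<subseteq> \<D> \<longrightarrow>
          inner_on N (fdiff i x n) (fdiff i x (n + diag (1/2)))
            = (s_fun i j (n i) (n j))\<^sup>2 * \<phi>\<^sub>i (n i)) \<and>
       (Q \<subseteq> \<D> \<longrightarrow>
          inner_on N (fdiff j x (n - evec j + diag (1/2))) (fdiff j x (n - evec j + diag 1))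
            = (s_fun i j (n i) (n j))\<^sup>2 * \<phi>\<^sub>j (n j)) \<and>
       (P \<subseteq> \<D> \<and> Q \<subseteq> \<D> \<longrightarrow>
          \<phi>\<^sub>i (n i) / \<phi>\<^sub>j (n j) =
            - ((\<Prod>m\<in>{1..N} - {i, j}. n i - n m + (real m - real i) / 2 + 1/2)
               / (\<Prod>m = 1..N. n i + of_int (\<alpha> m) + (real m - real i) / 2 + 1/2))
            * ((\<Prod>m = 1..N. n j + of_int (\<alpha> m) + (real m - real j) / 2)
               / (\<Prod>m\<in>{1..N} - {i, j}. n j - n m + (real m - real j) / 2 - 1/2))))"
proof -
  define \<sigma> :: real where "\<sigma> = (if i < j then -1 else 1)"
  define Ni where "Ni a = (\<Prod>m\<in>{1..N} - {i, j}. a - c m + (real m - real i) / 2 + 1/2)" for a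
  define Nj where "Nj b = (\<Prod>m\<in>{1..N} - {i, j}. b - c m + (real m - real j) / 2 - 1/2)" for b
  define Mi where "Mi a = (\<Prod>m = 1..N. a + of_int (\<alpha> m) + (real m - real i) / 2 + 1/2)" for a
  define Mj where "Mj b = (\<Prod>m = 1..N. b + of_int (\<alpha> m) + (real m - real j) / 2)" for b
  note anti = assms(4) and i = assms(5) and j = assms(6) and ij = assms(7)
  have \<D>: "interlaced N \<alpha> n" if "n \<in> \<D>" for n
    using that by (auto simp: \<D>_def dom_int_def dom_half_def)
  have sq: "(s_fun i j a b)\<^sup>2 = \<bar>a - b + (real j - real i) / 2 + 1/2\<bar>" for a b
    by (simp only: s_fun_def real_sqrt_pow2 abs_ge_zero)
  \<comment> \<open>\<open>u\<close> bounds the coordinate with the smaller index from above,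
    \<open>v\<close> the one with the larger index from below. The slacks 1 and 1/2 are the ones
    available for both scalar products, and they just suffice when i and j are neighbours.\<close>
  have s2: "(s_fun i j (n i) (n j))\<^sup>2 = \<sigma> * (n i - n j + (real j - real i) / 2 + 1/2)"
    if "i < j \<Longrightarrow> interlaced N \<alpha> u \<and> interlaced N \<alpha> v \<and> n i \<le> u i - 1 \<and> v j \<le> n j"
      "j < i \<Longrightarrow> interlaced N \<alpha> u \<and> interlaced N \<alpha> v \<and> n j \<le> u j - 1/2 \<and> v i \<le> n i + 1/2"
    for n u v
  proof (cases "i < j")
    case True
    then have "real j - real i \<ge> 1" by linarith
    moreover have "(real j - real i) / 2 \<le> - u i - of_int (\<alpha> j) - (real j - real i) / 2 + 1"
      using True i j that(1) by (intro interlaced_upper[OF anti]) auto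
    moreover have "0 \<le> v j + of_int (\<alpha> j)"
      using interlaced_lower[OF anti, of v j j] True i j that(1) by auto
    moreover have "n i \<le> u i - 1" "v j \<le> n j" using that(1) True by auto
    ultimately have "n i - n j + (real j - real i) / 2 + 1/2 \<le> 0" by (simp add: field_simps)
    then show ?thesis using True by (simp only: sq \<sigma>_def if_True abs_of_nonpos) simp
  next
    case False
    with ij have ji: "j < i" by simp
    then have "real i - real j \<ge> 1" by linarith
    moreover have "(real i - real j) / 2 \<le> - u j - of_int (\<alpha> i) - (real i - real j) / 2 + 1"
      using ji i j that(2) by (intro interlaced_upper[OF anti]) auto
    moreover have "0 \<le> v i + of_int (\<alpha> i)"
      using interlaced_lower[OF anti, of v i i] ji i j that(2) by auto
    moreover have "n j \<le> u j - 1/2" "v i \<le> n i + 1/2" using that(2) ji by auto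
    ultimately have "n i - n j + (real j - real i) / 2 + 1/2 \<ge> 0" by (simp add: field_simps)
    then show ?thesis using False by (simp only: sq \<sigma>_def if_False abs_of_nonneg) simp
  qed
  show ?thesis
  \<comment> \<open>Removing the factor m = j, respectively m = i, from the closed formula leaves
    these quotients. That factor is \<sigma> s^2 in direction i and -\<sigma> s^2 in direction j,
    whence the opposite signs.\<close>
  proof (rule exI[of _ "\<lambda>a. \<sigma> / 4 * (Ni a / Mi a)"], rule exI[of _ "\<lambda>b. - \<sigma> / 4 * (Nj b / Mj b)"],
      intro allI impI, unfold Let_def, intro conjI impI)
    fix n assume c: "\<forall>m\<in>{1..N} - {i, j}. n m = c m"
    have Ni: "Ni (n i) = (\<Prod>m\<in>{1..N} - {i, j}. n i - n m + (real m - real i) / 2 + 1/2)"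
      and Nj: "Nj (n j) = (\<Prod>m\<in>{1..N} - {i, j}. n j - n m + (real m - real j) / 2 - 1/2)"
      using c by (auto simp: Ni_def Nj_def intro!: prod.cong)
    have \<sigma>: "\<sigma> * (\<sigma> * z) = z" for z by (simp add: \<sigma>_def)
    have remi: "{1..N} - {i} - {j} = {1..N} - {i, j}" and remj: "{1..N} - {j} - {i} = {1..N} - {i, j}"
      by auto
    {
      assume "{n, n + evec i, n + diag (1/2), n + diag (1/2) + evec i} \<subseteq> \<D>"
      then have dom: "interlaced N \<alpha> n" "interlaced N \<alpha> (n + diag (1/2))"
        "interlaced N \<alpha> (n + diag (1/2) + evec i)"
        using \<D> by auto
      have s: "(s_fun i j (n i) (n j))\<^sup>2 = \<sigma> * (n i - n j + (real j - real i) / 2 + 1/2)"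
        by (rule s2[where u = "n + diag (1/2) + evec i" and v = n])
           (use dom ij in \<open>auto simp: diag_def evec_def\<close>)
      have "inner_on N (fdiff i x n) (fdiff i x (n + diag (1/2)))
        = (n i - n j + (real j - real i) / 2 + 1/2) * Ni (n i) / Mi (n i) / 4"
        unfolding x_def inner_fdiff_conf_coord[OF anti i dom(1-3)] Ni Mi_def
        using j ij by (subst prod.remove[of "{1..N} - {i}" j]) (auto simp: remi[simplified])
      then show "inner_on N (fdiff i x n) (fdiff i x (n + diag (1/2)))
        = (s_fun i j (n i) (n j))\<^sup>2 * (\<sigma> / 4 * (Ni (n i) / Mi (n i)))"
        unfolding s by (simp add: mult_ac \<sigma>)
    }
    {
      \<comment> \<open>Base point for the closed formula in direction j. Its j-th coordinate is n_j
        - 1/2 and the others are n_m + 1/2: differences n_j - n_m drop by 1, turning +1/2 into -1/2,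
        and the denominator factors lose their 1/2.\<close>
      let ?n = "n - evec j + diag (1/2)"
      have shift: "?n + diag (1/2) = n - evec j + diag 1" "?n + diag (1/2) + evec j = n + diag 1"
        by (auto simp: diag_def)
      assume "{?n, n + diag (1/2), n - evec j + diag 1, n + diag 1} \<subseteq> \<D>"
      then have dom: "interlaced N \<alpha> ?n" "interlaced N \<alpha> (?n + diag (1/2))"
        "interlaced N \<alpha> (?n + diag (1/2) + evec j)"
        unfolding shift using \<D> by auto
      have s: "(s_fun i j (n i) (n j))\<^sup>2 = \<sigma> * (n i - n j + (real j - real i) / 2 + 1/2)"
        by (rule s2[where u = "n + diag 1" and v = ?n])
           (use dom(1) dom(3)[unfolded shift] ij in \<open>auto simp: diag_def evec_def\<close>)
      have "inner_on N (fdiff j x ?n) (fdiff j x (n - evec j + diag 1))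
        = (\<Prod>m\<in>{1..N} - {j}. ?n j - ?n m + (real m - real j) / 2 + 1/2)
          / (\<Prod>m = 1..N. ?n j + of_int (\<alpha> m) + (real m - real j) / 2 + 1/2) / 4"
        using inner_fdiff_conf_coord[OF anti j dom] unfolding shift x_def .
      also have "(\<Prod>m = 1..N. ?n j + of_int (\<alpha> m) + (real m - real j) / 2 + 1/2) = Mj (n j)"
        unfolding Mj_def by (intro prod.cong) (auto simp: evec_def diag_def)
      also have "(\<Prod>m\<in>{1..N} - {j}. ?n j - ?n m + (real m - real j) / 2 + 1/2)
        = (\<Prod>m\<in>{1..N} - {j}. n j - n m + (real m - real j) / 2 - 1/2)"
        by (intro prod.cong) (auto simp: evec_def diag_def)
      also have "\<dots> = - (n i - n j + (real j - real i) / 2 + 1/2) * Nj (n j)"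
        unfolding Nj using i ij
        by (subst prod.remove[of "{1..N} - {j}" i]) (auto simp: remj[simplified] field_simps)
      also have "- (n i - n j + (real j - real i) / 2 + 1/2) * Nj (n j) / Mj (n j) / 4
        = (s_fun i j (n i) (n j))\<^sup>2 * (- \<sigma> / 4 * (Nj (n j) / Mj (n j)))"
        unfolding s by (simp only: minus_mult_left[symmetric] minus_divide_left[symmetric]
            mult_minus_right) (simp add: mult_ac \<sigma>)
      finally show "inner_on N (fdiff j x ?n) (fdiff j x (n - evec j + diag 1))
        = (s_fun i j (n i) (n j))\<^sup>2 * (- \<sigma> / 4 * (Nj (n j) / Mj (n j)))" .
    }
    \<comment> \<open>The constants have quotient -1 as \<sigma> is 1 or -1. The rest is inversion
      of a fraction, valid even for vanishing terms under the convention x / 0 = 0.\<close>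
    show "\<sigma> / 4 * (Ni (n i) / Mi (n i)) / (- \<sigma> / 4 * (Nj (n j) / Mj (n j))) =
        - ((\<Prod>m\<in>{1..N} - {i, j}. n i - n m + (real m - real i) / 2 + 1/2)
           / (\<Prod>m = 1..N. n i + of_int (\<alpha> m) + (real m - real i) / 2 + 1/2))
        * ((\<Prod>m = 1..N. n j + of_int (\<alpha> m) + (real m - real j) / 2)
           / (\<Prod>m\<in>{1..N} - {i, j}. n j - n m + (real m - real j) / 2 - 1/2))"
      unfolding Ni[symmetric] Nj[symmetric] Mi_def[symmetric] Mj_def[symmetric]
      by (simp add: \<sigma>_def)
  qed
qed

end
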